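(* Let $P$ be a GPEA, and let $U$ be its $\gamma$-unitization. Then $P$ is a normal Riesz ideal in $U$ iff $P$ is upward directed.
   Context: $P$ is a GPEA (partial operation $\oplus$, constant $0$; partial associativity; conjugation: if $a\oplus b$ exists there are $c,d$ with $a\oplus b=c\oplus a=b\oplus d$; two-sided cancellation; $0$ neutral; positivity). Order: $a\le b$ iff $a\oplus c=b$ for some $c$; for $a\le b$, $a/b$ is the unique $c$ with $a\oplus c=b$ and $b\backslash a$ the unique $d$ with $d\oplus a=b$. $\gamma$ is a unitizing GPEA-automorphism of $P$: a GPEA-automorphism with $\gamma a\oplus b$ defined iff $b\oplus a$ defined. The $\gamma$-unitization: $U=P\cup P^\eta$ with $\eta\colon P\to P^\eta$ a bijection onto a disjoint set, $1:=\eta0$, and $+$: sums within $P$ as in $P$; $a+\eta b$ defined iff $a\le b$, equal to $\eta(b\backslash a)$; $\eta a+b$ defined iff $\gamma b\le a$, equal to $\eta(\gamma b/a)$; no sums of two elements of $P^\eta$. $U$ is a pseudo effect algebra (GPEA with top $1$) with $\eta a=a^\sim$, $\gamma a=a^{--}$. In a GPEA, an ideal is a nonempty down-set closed under existing sums; normal iff $a\oplus c=c\oplus b$ implies ($a\in I\Leftrightarrow b\in I$). (R1): if $i\in I$, $a\oplus b$ exists, $i\le a\oplus b$, then there are $j,k\in I$, $j\le a$, $k\le b$, $i\le j\oplus k$. A Riesz ideal is an R1-ideal satisfying (R2): if $i\in I$, $i\le a$, then (i) if $(a\backslash i)\oplus b$ exists there is $j\in I$, $j\le b$, with $a\oplus(j/b)$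 existing, and (ii) if $b\oplus(i/a)$ exists there is $k\in I$, $k\le b$, with $(b\backslash k)\oplus a$ existing. Upward directed: any two elements have a common upper bound. *)

theory Defs
  imports Main
begin

text \<open>A partial operation is an \<^typ>\<open>'a option\<close>-valued function; \<open>None\<close> means that the sum is
  not defined.  Its values outside the carrier are irrelevant.\<close>

record 'a partial_alg =
  carrier :: "'a set"
  psum :: "'a \<Rightarrow> 'a \<Rightarrow> 'a option"
  pzero :: 'a

text \<open>Generalized pseudo effect algebras.  The equation in \<open>assoc\<close> says that one side exists iff
  the other does, and that they are then equal.\<close>

locale gpea =
  fixes P :: "'a partial_alg"
  assumes zero_closed: "pzero P \<in> carrier P"
    and sum_closed:
      "\<lbrakk>a \<in> carrier P; b \<in> carrier P; psum P a b = Some c\<rbrakk> \<Longrightarrow> c \<in> carrier P"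
    and assoc:
      "\<lbrakk>a \<in> carrier P; b \<in> carrier P; c \<in> carrier P\<rbrakk> \<Longrightarrow>
        Option.bind (psum P a b) (\<lambda>s. psum P s c) = Option.bind (psum P b c) (\<lambda>t. psum P a t)"
    and conjugation:
      "\<lbrakk>a \<in> carrier P; b \<in> carrier P; psum P a b = Some s\<rbrakk> \<Longrightarrow>
        \<exists>c\<in>carrier P. \<exists>d\<in>carrier P. psum P c a = Some s \<and> psum P b d = Some s"
    and cancel_left:
      "\<lbrakk>a \<in> carrier P; b \<in> carrier P; c \<in> carrier P;
        psum P c a = Some s; psum P c b = Some s\<rbrakk> \<Longrightarrow> a = b"
    and cancel_right:
      "\<lbrakk>a \<in> carrier P; b \<in> carrier P; c \<in> carrier P;
        psum P a c = Some s; psum P b c = Some s\<rbrakk> \<Longrightarrow> a = b"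
    and zero_right: "a \<in> carrier P \<Longrightarrow> psum P a (pzero P) = Some a"
    and zero_left: "a \<in> carrier P \<Longrightarrow> psum P (pzero P) a = Some a"
    and positivity:
      "\<lbrakk>a \<in> carrier P; b \<in> carrier P; psum P a b = Some (pzero P)\<rbrakk> \<Longrightarrow>
        a = pzero P \<and> b = pzero P"

definition summable :: "'a partial_alg \<Rightarrow> 'a \<Rightarrow> 'a \<Rightarrow> bool" where
  "summable P a b \<longleftrightarrow> psum P a b \<noteq> None"

definition le :: "'a partial_alg \<Rightarrow> 'a \<Rightarrow> 'a \<Rightarrow> bool" where
  "le P a b \<longleftrightarrow> (\<exists>c\<in>carrier P. psum P a c = Some b)"

text \<open>For \<open>a \<le> b\<close>: \<open>ldiff P a b\<close> is \<open>a / b\<close> and \<open>rdiff P b a\<close> is \<open>b\<close> backslash \<open>a\<close>.\<close>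

definition ldiff :: "'a partial_alg \<Rightarrow> 'a \<Rightarrow> 'a \<Rightarrow> 'a" where
  "ldiff P a b = (THE c. c \<in> carrier P \<and> psum P a c = Some b)"

definition rdiff :: "'a partial_alg \<Rightarrow> 'a \<Rightarrow> 'a \<Rightarrow> 'a" where
  "rdiff P b a = (THE d. d \<in> carrier P \<and> psum P d a = Some b)"

definition upward_directed :: "'a partial_alg \<Rightarrow> bool" where
  "upward_directed P \<longleftrightarrow>
    (\<forall>a\<in>carrier P. \<forall>b\<in>carrier P. \<exists>c\<in>carrier P. le P a c \<and> le P b c)"

definition gpea_morphism ::
    "'a partial_alg \<Rightarrow> 'b partial_alg \<Rightarrow> ('a \<Rightarrow> 'b) \<Rightarrow> bool" where
  "gpea_morphism P Q f \<longleftrightarrow>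
    f ` carrier P \<subseteq> carrier Q \<and>
    (\<forall>a\<in>carrier P. \<forall>b\<in>carrier P. \<forall>c.
      psum P a b = Some c \<longrightarrow> psum Q (f a) (f b) = Some (f c))"

definition gpea_automorphism :: "'a partial_alg \<Rightarrow> ('a \<Rightarrow> 'a) \<Rightarrow> bool" where
  "gpea_automorphism P g \<longleftrightarrow>
    bij_betw g (carrier P) (carrier P) \<and>
    gpea_morphism P P g \<and> gpea_morphism P P (inv_into (carrier P) g)"

definition unitizing_automorphism :: "'a partial_alg \<Rightarrow> ('a \<Rightarrow> 'a) \<Rightarrow> bool" where
  "unitizing_automorphism P g \<longleftrightarrow>
    gpea_automorphism P g \<and>
    (\<forall>a\<in>carrier P. \<forall>b\<in>carrier P. summable P (g a) b \<longleftrightarrow> summable P b a)"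

text \<open>The \<open>\<gamma>\<close>-unitization lives on the disjoint sum: \<open>Inl\<close> embeds \<open>P\<close>, and \<open>Inr\<close> plays the
  role of the bijection \<open>\<eta>\<close> onto a disjoint copy of \<open>P\<close>.\<close>

fun unitization_sum ::
    "'a partial_alg \<Rightarrow> ('a \<Rightarrow> 'a) \<Rightarrow> 'a + 'a \<Rightarrow> 'a + 'a \<Rightarrow> ('a + 'a) option" where
  "unitization_sum P g (Inl a) (Inl b) = map_option Inl (psum P a b)"
| "unitization_sum P g (Inl a) (Inr b) =
    (if le P a b then Some (Inr (rdiff P b a)) else None)"
| "unitization_sum P g (Inr a) (Inl b) =
    (if le P (g b) a then Some (Inr (ldiff P (g b) a)) else None)"
| "unitization_sum P g (Inr a) (Inr b) = None"

definition unitization :: "'a partial_alg \<Rightarrow> ('a \<Rightarrow> 'a) \<Rightarrow> ('a + 'a) partial_alg" where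
  "unitization P g =
    \<lparr>carrier = Inl ` carrier P \<union> Inr ` carrier P,
     psum = unitization_sum P g,
     pzero = Inl (pzero P)\<rparr>"

definition gpea_ideal :: "'a partial_alg \<Rightarrow> 'a set \<Rightarrow> bool" where
  "gpea_ideal P I \<longleftrightarrow>
    I \<subseteq> carrier P \<and> I \<noteq> {} \<and>
    (\<forall>a\<in>carrier P. \<forall>b\<in>I. le P a b \<longrightarrow> a \<in> I) \<and>
    (\<forall>a\<in>I. \<forall>b\<in>I. \<forall>c. psum P a b = Some c \<longrightarrow> c \<in> I)"

definition normal_ideal :: "'a partial_alg \<Rightarrow> 'a set \<Rightarrow> bool" where
  "normal_ideal P I \<longleftrightarrow>
    gpea_ideal P I \<and>
    (\<forall>a\<in>carrier P. \<forall>b\<in>carrier P. \<forall>c\<in>carrier P. \<forall>s.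
      psum P a c = Some s \<and> psum P c b = Some s \<longrightarrow> (a \<in> I \<longleftrightarrow> b \<in> I))"

definition R1 :: "'a partial_alg \<Rightarrow> 'a set \<Rightarrow> bool" where
  "R1 P I \<longleftrightarrow>
    (\<forall>i\<in>I. \<forall>a\<in>carrier P. \<forall>b\<in>carrier P. \<forall>s.
      psum P a b = Some s \<and> le P i s \<longrightarrow>
        (\<exists>j\<in>I. \<exists>k\<in>I. le P j a \<and> le P k b \<and> (\<exists>t. psum P j k = Some t \<and> le P i t)))"

definition R2 :: "'a partial_alg \<Rightarrow> 'a set \<Rightarrow> bool" where
  "R2 P I \<longleftrightarrow>
    (\<forall>i\<in>I. \<forall>a\<in>carrier P. \<forall>b\<in>carrier P. le P i a \<longrightarrow>
      (summable P (rdiff P a i) b \<longrightarrow>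
        (\<exists>j\<in>I. le P j b \<and> summable P a (ldiff P j b))) \<and>
      (summable P b (ldiff P i a) \<longrightarrow>
        (\<exists>k\<in>I. le P k b \<and> summable P (rdiff P b k) a)))"

definition R1_ideal :: "'a partial_alg \<Rightarrow> 'a set \<Rightarrow> bool" where
  "R1_ideal P I \<longleftrightarrow> gpea_ideal P I \<and> R1 P I"

definition riesz_ideal :: "'a partial_alg \<Rightarrow> 'a set \<Rightarrow> bool" where
  "riesz_ideal P I \<longleftrightarrow> R1_ideal P I \<and> R2 P I"

end

theory Submission imports Defs begin

text \<open>In the unitization \<open>U\<close>, \<open>i \<le> \<eta>b\<close> holds iff \<open>b \<oplus> i\<close> exists, and then
  \<open>i / \<eta>b = \<eta>(b \<oplus> i)\<close>. The set \<open>P\<close> is always a normal ideal of \<open>U\<close>, because a sum in \<open>U\<close> lies in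
  \<open>P\<close> iff both summands do. Only sums with exactly one summand in \<open>\<eta>P\<close> make R1 and R2
  nontrivial, and there they ask for common upper bounds in \<open>P\<close>: given \<open>u \<ge> d \<oplus> a, d \<oplus> i\<close>,
  write \<open>u = d \<oplus> v\<close> with \<open>v \<ge> a, i\<close>. Conversely, R2 applied to \<open>i = a\<close> and the defined
  sum \<open>0 + \<eta>b\<close> yields \<open>j\<close> with \<open>a \<le> b \<oplus> j\<close>.\<close>

section \<open>Associativity, order and directedness in a GPEA\<close>

context gpea
begin

lemma assoc_rightD:
  assumes "a \<in> carrier P" "b \<in> carrier P" "c \<in> carrier P"
    and "psum P a b = Some s" "psum P s c = Some t"
  obtains u where "u \<in> carrier P" "psum P b c = Some u" "psum P a u = Some t"
  using assoc[OF assms(1-3)] assms sum_closed[OF assms(2,3)]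
  by (auto split: Option.bind_splits)

lemma assoc_leftD:
  assumes "a \<in> carrier P" "b \<in> carrier P" "c \<in> carrier P"
    and "psum P b c = Some u" "psum P a u = Some t"
  obtains s where "s \<in> carrier P" "psum P a b = Some s" "psum P s c = Some t"
  using assoc[OF assms(1-3)] assms sum_closed[OF assms(1,2)]
  by (auto split: Option.bind_splits)

text \<open>Conjugation moves a complement from one side of \<open>a\<close> to the other, so left
  and right differences exist under the same condition.\<close>

lemma le_iff_left_summand:
  assumes "a \<in> carrier P"
  shows "le P a b \<longleftrightarrow> (\<exists>d\<in>carrier P. psum P d a = Some b)"
  unfolding le_def using conjugation assms by metis

lemma ldiff_eq:
  assumes "a \<in> carrier P" "c \<in> carrier P" "psum P a c = Some b"
  shows "ldiff P a b = c"
  unfolding ldiff_def using assms cancel_left by blast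

lemma rdiff_eq:
  assumes "a \<in> carrier P" "d \<in> carrier P" "psum P d a = Some b"
  shows "rdiff P b a = d"
  unfolding rdiff_def using assms cancel_right by blast

text \<open>Reassociating \<open>(d \<oplus> a) \<oplus> c = u\<close> to
  \<open>d \<oplus> (a \<oplus> c) = d \<oplus> v\<close> lets \<open>d\<close> be
  cancelled.\<close>

lemma le_sum_cancel_left:
  assumes "d \<in> carrier P" "a \<in> carrier P" "v \<in> carrier P"
    and "psum P d a = Some s" "psum P d v = Some u" "le P s u"
  shows "le P a v"
proof -
  obtain c where c: "c \<in> carrier P" "psum P s c = Some u"
    using assms(6) by (auto simp: le_def)
  obtain w where w: "w \<in> carrier P" "psum P a c = Some w" "psum P d w = Some u"
    using assoc_rightD[OF assms(1,2) c(1) assms(4) c(2)] .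
  then have "w = v"
    using cancel_left assms by blast
  then show ?thesis
    using w c by (auto simp: le_def)
qed

text \<open>Bounding \<open>d \<oplus> a\<close> and \<open>d \<oplus> i\<close> rather than
  \<open>a\<close> and \<open>i\<close> keeps the bound \<open>v\<close> summable with
  \<open>d\<close>, which both mixed cases of R1 rely on.\<close>

lemma upward_directed_summands:
  assumes "upward_directed P" "d \<in> carrier P" "a \<in> carrier P" "i \<in> carrier P"
    and "psum P d a = Some s" "psum P d i = Some t"
  obtains u v where "v \<in> carrier P" "psum P d v = Some u" "le P a v" "le P i v"
proof -
  have "s \<in> carrier P" "t \<in> carrier P"
    using assms sum_closed by blast+
  then obtain u where u: "le P s u" "le P t u"
    using assms(1) by (auto simp: upward_directed_def)
  obtain c where c: "c \<in> carrier P" "psum P s c = Some u"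
    using u(1) by (auto simp: le_def)
  obtain v where v: "v \<in> carrier P" "psum P d v = Some u"
    using assoc_rightD[OF assms(2,3) c(1) assms(5) c(2)] .
  show thesis
    using that[OF v] le_sum_cancel_left[OF assms(2,3) v(1) assms(5) v(2) u(1)]
      le_sum_cancel_left[OF assms(2,4) v(1) assms(6) v(2) u(2)] .
qed

end

section \<open>The unitizing automorphism\<close>

locale unitizing_gpea = gpea +
  fixes \<gamma> :: "'a \<Rightarrow> 'a"
  assumes unitizing: "unitizing_automorphism P \<gamma>"
begin

abbreviation "U \<equiv> unitization P \<gamma>"

lemma carrier_U: "carrier U = Inl ` carrier P \<union> Inr ` carrier P"
  and pzero_U: "pzero U = Inl (pzero P)"
  by (simp_all add: unitization_def)

lemma gamma_bij: "bij_betw \<gamma> (carrier P) (carrier P)"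
  using unitizing by (simp add: unitizing_automorphism_def gpea_automorphism_def)

lemma gamma_closed: "a \<in> carrier P \<Longrightarrow> \<gamma> a \<in> carrier P"
  using gamma_bij by (auto simp: bij_betw_def)

lemma gamma_inj: "\<lbrakk>a \<in> carrier P; b \<in> carrier P; \<gamma> a = \<gamma> b\<rbrakk> \<Longrightarrow> a = b"
  using gamma_bij by (auto simp: bij_betw_def inj_on_def)

lemma gamma_cancel_right:
  assumes "a \<in> carrier P" "b \<in> carrier P" "c \<in> carrier P"
    and "psum P (\<gamma> a) c = Some s" "psum P (\<gamma> b) c = Some s"
  shows "a = b"
  using gamma_inj[OF assms(1,2)] cancel_right[OF _ _ assms(3-5)] gamma_closed assms(1,2) by blast

lemma gamma_surj:
  assumes "b \<in> carrier P"
  obtains a where "a \<in> carrier P" "\<gamma> a = b"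
  using gamma_bij assms by (metis bij_betw_def imageE)

lemma summable_gamma:
  "\<lbrakk>a \<in> carrier P; b \<in> carrier P\<rbrakk> \<Longrightarrow> summable P (\<gamma> a) b \<longleftrightarrow> summable P b a"
  using unitizing by (simp add: unitizing_automorphism_def)

text \<open>A morphism maps 0 to an idempotent, and by cancellation 0 is the only one.\<close>

lemma gamma_zero: "\<gamma> (pzero P) = pzero P"
proof -
  have "gpea_morphism P P \<gamma>"
    using unitizing by (simp add: unitizing_automorphism_def gpea_automorphism_def)
  then have "psum P (\<gamma> (pzero P)) (\<gamma> (pzero P)) = Some (\<gamma> (pzero P))"
    using zero_closed zero_left by (auto simp: gpea_morphism_def)
  then show ?thesis
    using cancel_left zero_right zero_closed gamma_closed by blast
qed

section \<open>Sums, cancellation and zero in the unitization\<close>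

lemma psum_Inl_Inl: "psum U (Inl a) (Inl b) = Some x \<longleftrightarrow> (\<exists>c. x = Inl c \<and> psum P a b = Some c)"
  by (auto simp: unitization_def)

text \<open>The guard and the definite description merge into one equation in \<open>P\<close>; with
  the mirror image below, this reduces cancellation in \<open>U\<close> to cancellation in
  \<open>P\<close>.\<close>

lemma psum_Inl_Inr:
  assumes "a \<in> carrier P"
  shows "psum U (Inl a) (Inr b) = Some x \<longleftrightarrow> (\<exists>d\<in>carrier P. x = Inr d \<and> psum P d a = Some b)"
  using assms rdiff_eq by (force simp: unitization_def le_iff_left_summand)

lemma psum_Inr_Inl:
  assumes "b \<in> carrier P"
  shows "psum U (Inr a) (Inl b) = Some x \<longleftrightarrow> (\<exists>d\<in>carrier P. x = Inr d \<and> psum P (\<gamma> b) d = Some a)"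
  using assms gamma_closed ldiff_eq by (force simp: unitization_def le_def)

lemma psum_Inr_Inr: "psum U (Inr a) (Inr b) = None"
  by (simp add: unitization_def)

lemmas psum_U = psum_Inl_Inl psum_Inl_Inr psum_Inr_Inl psum_Inr_Inr

text \<open>The tags of \<open>z\<close> and \<open>s\<close> force \<open>x\<close> and
  \<open>y\<close> onto the same side. If \<open>z\<close> lies in \<open>\<eta>P\<close>,
  cancellation gives \<open>\<gamma> a = \<gamma> b\<close> and injectivity finishes.\<close>

lemma U_cancel_left:
  assumes "x \<in> carrier U" "y \<in> carrier U" "z \<in> carrier U"
    and "psum U z x = Some s" "psum U z y = Some s"
  shows "x = y"
  using assms
  by (auto simp: carrier_U psum_U)
    (erule (4) cancel_left cancel_right gamma_cancel_right)+

lemma U_cancel_right: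
  assumes "x \<in> carrier U" "y \<in> carrier U" "z \<in> carrier U"
    and "psum U x z = Some s" "psum U y z = Some s"
  shows "x = y"
  using assms
  by (auto simp: carrier_U psum_U)
    (erule (4) cancel_left cancel_right gamma_cancel_right)+

lemma U_ldiff_eq:
  assumes "x \<in> carrier U" "z \<in> carrier U" "psum U x z = Some y"
  shows "ldiff U x y = z"
  unfolding ldiff_def using assms U_cancel_left by blast

lemma U_rdiff_eq:
  assumes "x \<in> carrier U" "z \<in> carrier U" "psum U z x = Some y"
  shows "rdiff U y x = z"
  unfolding rdiff_def using assms U_cancel_right by blast

lemma U_zero_closed: "pzero U \<in> carrier U"
  using zero_closed by (simp add: carrier_U pzero_U)

lemma U_zero_right: "x \<in> carrier U \<Longrightarrow> psum U x (pzero U) = Some x"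
  using zero_closed zero_left zero_right
  by (auto simp: carrier_U pzero_U psum_U gamma_zero)

lemma U_zero_left: "x \<in> carrier U \<Longrightarrow> psum U (pzero U) x = Some x"
  using zero_closed zero_left zero_right
  by (auto simp: carrier_U pzero_U psum_U)

lemma U_ldiff_self: "x \<in> carrier U \<Longrightarrow> ldiff U x x = pzero U"
  using U_ldiff_eq U_zero_right U_zero_closed by blast

lemma U_rdiff_self: "x \<in> carrier U \<Longrightarrow> rdiff U x x = pzero U"
  using U_rdiff_eq U_zero_left U_zero_closed by blast

lemma U_le_refl: "x \<in> carrier U \<Longrightarrow> le U x x"
  unfolding le_def using U_zero_closed U_zero_right by blast

lemma U_summable_zero:
  "x \<in> carrier U \<Longrightarrow> summable U x (pzero U)"
  "x \<in> carrier U \<Longrightarrow> summable U (pzero U) x"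
  by (simp_all add: summable_def U_zero_left U_zero_right)

section \<open>Order and differences in the unitization\<close>

lemma le_Inl_Inl: "a \<in> carrier P \<Longrightarrow> le U (Inl a) (Inl b) \<longleftrightarrow> le P a b"
  by (auto simp: le_def carrier_U bex_Un psum_U)

lemma le_Inl_Inr:
  assumes "a \<in> carrier P" "b \<in> carrier P"
  shows "le U (Inl a) (Inr b) \<longleftrightarrow> summable P b a"
  using assms sum_closed[of b a] by (auto simp: le_def carrier_U bex_Un psum_U summable_def)

lemma le_Inr_Inl: "a \<in> carrier P \<Longrightarrow> \<not> le U (Inr a) (Inl b)"
  by (auto simp: le_def carrier_U psum_U)

lemma ldiff_Inl_Inr:
  assumes "a \<in> carrier P" "b \<in> carrier P" "psum P b a = Some c"
  shows "ldiff U (Inl a) (Inr b) = Inr c"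
  using assms sum_closed[of b a] by (intro U_ldiff_eq) (auto simp: carrier_U psum_U)

text \<open>\<open>\<eta>c + a = \<eta>b\<close> unfolds to
  \<open>\<gamma> a \<oplus> b = c\<close>. As \<open>\<gamma>\<close> is unitizing, this sum exists
  exactly when \<open>b \<oplus> a\<close> does, that is, when
  \<open>a \<le> \<eta>b\<close>.\<close>

lemma rdiff_Inr_Inl:
  assumes "a \<in> carrier P" "b \<in> carrier P" "psum P (\<gamma> a) b = Some c"
  shows "rdiff U (Inr b) (Inl a) = Inr c"
  using assms sum_closed[OF gamma_closed[of a]]
  by (intro U_rdiff_eq) (auto simp: carrier_U psum_U)

lemma summable_Inl_Inr:
  "a \<in> carrier P \<Longrightarrow> summable U (Inl a) (Inr b) \<longleftrightarrow> le P a b"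
  by (auto simp: summable_def unitization_def)

lemma summable_Inr_Inl: "summable U (Inr a) (Inl b) \<longleftrightarrow> le P (\<gamma> b) a"
  by (auto simp: summable_def unitization_def)

section \<open>Normality and the Riesz conditions for \<open>P\<close>\<close>

lemma normal_ideal_P: "normal_ideal U (Inl ` carrier P)"
  unfolding normal_ideal_def gpea_ideal_def
proof (intro conjI ballI allI impI)
  show "Inl ` carrier P \<noteq> {}"
    using zero_closed by auto
  show "Inl ` carrier P \<subseteq> carrier U"
    by (auto simp: carrier_U)
next
  fix x y assume "x \<in> carrier U" "y \<in> Inl ` carrier P" "le U x y"
  then show "x \<in> Inl ` carrier P"
    using le_Inr_Inl by (auto simp: carrier_U)
next
  fix x y z assume "x \<in> Inl ` carrier P" "y \<in> Inl ` carrier P" "psum U x y = Some z"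
  then show "z \<in> Inl ` carrier P"
    by (auto simp: psum_U) (rule imageI, erule (2) sum_closed)
next
  \<comment> \<open>If \<open>z\<close> lies in \<open>\<eta>P\<close>, both \<open>x\<close> and
    \<open>y\<close> must lie in \<open>P\<close>; if \<open>z\<close> lies in \<open>P\<close>,
    both lie on the side of \<open>s\<close>.\<close>
  fix x y z s assume "x \<in> carrier U" "y \<in> carrier U" "z \<in> carrier U"
    and "psum U x z = Some s \<and> psum U z y = Some s"
  then show "x \<in> Inl ` carrier P \<longleftrightarrow> y \<in> Inl ` carrier P"
    by (auto simp: carrier_U psum_U)
qed

lemma R1_P:
  assumes dir: "upward_directed P"
  shows "R1 U (Inl ` carrier P)"
  unfolding R1_def
proof (intro ballI allI impI)
  let ?I = "Inl ` carrier P"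
  fix i' x y s
  assume "i' \<in> ?I" and x: "x \<in> carrier U" and y: "y \<in> carrier U"
    and s: "psum U x y = Some s \<and> le U i' s"
  then obtain i where i: "i' = Inl i" "i \<in> carrier P"
    by blast
  consider (PP) a b where "a \<in> carrier P" "b \<in> carrier P" "x = Inl a" "y = Inl b"
    | (PE) a b where "a \<in> carrier P" "b \<in> carrier P" "x = Inl a" "y = Inr b"
    | (EP) a b where "a \<in> carrier P" "b \<in> carrier P" "x = Inr a" "y = Inl b"
    using x y s by (auto simp: carrier_U psum_U)
  then show "\<exists>j\<in>?I. \<exists>k\<in>?I. le U j x \<and> le U k y \<and> (\<exists>t. psum U j k = Some t \<and> le U i' t)"
  proof cases
    case PP
    \<comment> \<open>The summands themselves serve as \<open>j\<close> and \<open>k\<close>, with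
      \<open>t = s\<close>.\<close>
    then show ?thesis
      using s U_le_refl x y by blast
  next
    case PE
    then obtain d where d: "d \<in> carrier P" "psum P d a = Some b" "s = Inr d"
      using s by (auto simp: psum_U)
    then obtain t where t: "psum P d i = Some t"
      using s i by (auto simp: le_Inl_Inr summable_def)
    obtain u v where v: "v \<in> carrier P" "psum P d v = Some u" "le P a v" "le P i v"
      using upward_directed_summands[OF dir d(1) PE(1) i(2) d(2) t] .
    \<comment> \<open>Take \<open>j = a\<close> and \<open>k = a / v\<close>. Then
      \<open>j \<oplus> k = v\<close> is above \<open>i\<close>, and
      \<open>b \<oplus> k = (d \<oplus> a) \<oplus> k = d \<oplus> v\<close> exists, so
      \<open>k \<le> \<eta>b\<close>.\<close>
    obtain k where k: "k \<in> carrier P" "psum P a k = Some v"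
      using v(3) by (auto simp: le_def)
    have "psum P b k = Some u"
      using assoc_leftD[OF d(1) PE(1) k v(2)] d(2) by auto
    then have "le U (Inl k) y"
      using PE k by (simp add: le_Inl_Inr summable_def)
    moreover have "psum U (Inl a) (Inl k) = Some (Inl v)" "le U i' (Inl v)"
      using k v i by (simp_all add: psum_U le_Inl_Inl)
    ultimately show ?thesis
      using PE k x U_le_refl by blast
  next
    case EP
    then obtain d where d: "d \<in> carrier P" "psum P (\<gamma> b) d = Some a" "s = Inr d"
      using s by (auto simp: psum_U)
    then obtain t where t: "psum P d i = Some t"
      using s i by (auto simp: le_Inl_Inr summable_def)
    \<comment> \<open>The unitizing property turns \<open>\<gamma> b \<oplus> d\<close> into a sum
      with \<open>d\<close> on the left, so that \<open>b\<close> and \<open>i\<close> can be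
      bounded after \<open>d\<close>.\<close>
    have "summable P d b"
      using d EP summable_gamma[of b d] by (simp add: summable_def)
    then obtain r where r: "psum P d b = Some r"
      by (auto simp: summable_def)
    obtain u v where v: "v \<in> carrier P" "psum P d v = Some u" "le P b v" "le P i v"
      using upward_directed_summands[OF dir d(1) EP(2) i(2) r t] .
    obtain j where j: "j \<in> carrier P" "psum P j b = Some v"
      using v(3) EP by (auto simp: le_iff_left_summand)
    obtain w where w: "w \<in> carrier P" "psum P d j = Some w" "psum P w b = Some u"
      using assoc_leftD[OF d(1) j(1) EP(2) j(2) v(2)] .
    \<comment> \<open>Moving \<open>b\<close> back to the left as \<open>\<gamma> b\<close> gives
      \<open>\<gamma> b \<oplus> (d \<oplus> j) = a \<oplus> j\<close>, whose existence means
      \<open>j \<le> \<eta>a\<close>.\<close>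
    have "summable P (\<gamma> b) w"
      using w EP summable_gamma[of b w] by (simp add: summable_def)
    then obtain z where z: "psum P (\<gamma> b) w = Some z"
      by (auto simp: summable_def)
    have "psum P a j = Some z"
      using assoc_leftD[OF gamma_closed[OF EP(2)] d(1) j(1) w(2) z] d(2) by auto
    then have "le U (Inl j) x"
      using EP j by (simp add: le_Inl_Inr summable_def)
    moreover have "psum U (Inl j) (Inl b) = Some (Inl v)" "le U i' (Inl v)"
      using j v i by (simp_all add: psum_U le_Inl_Inl)
    ultimately show ?thesis
      using EP j y U_le_refl by blast
  qed
qed

lemma R2_P:
  assumes dir: "upward_directed P"
  shows "R2 U (Inl ` carrier P)"
  unfolding R2_def
proof (intro ballI impI conjI)
  let ?I = "Inl ` carrier P"
  fix i' x y
  assume "i' \<in> ?I" and x: "x \<in> carrier U" and y: "y \<in> carrier U" and le: "le U i' x"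
    and sm: "summable U (rdiff U x i') y"
  then obtain i where i: "i' = Inl i" "i \<in> carrier P"
    by blast
  consider (P) "y \<in> ?I"
    | (PE) a b where "a \<in> carrier P" "b \<in> carrier P" "x = Inl a" "y = Inr b"
    | (EE) a b where "a \<in> carrier P" "b \<in> carrier P" "x = Inr a" "y = Inr b"
    using x y by (auto simp: carrier_U)
  then show "\<exists>j\<in>?I. le U j y \<and> summable U x (ldiff U j y)"
  proof cases
    case P
    \<comment> \<open>For \<open>j = y\<close> the difference is 0, which is summable with
      everything.\<close>
    then show ?thesis
      using x y U_le_refl U_ldiff_self U_summable_zero by metis
  next
    case PE
    \<comment> \<open>Since \<open>j / \<eta>b = \<eta>(b \<oplus> j)\<close>, the goal asks for
      \<open>a \<le> b \<oplus> j\<close>; a common upper bound supplies \<open>j\<close>.\<close>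
    obtain u where u: "le P a u" "le P b u"
      using dir PE by (auto simp: upward_directed_def)
    then obtain j where j: "j \<in> carrier P" "psum P b j = Some u"
      by (auto simp: le_def)
    have "le U (Inl j) y" "summable U x (ldiff U (Inl j) y)"
      using PE j u by (simp_all add: le_Inl_Inr summable_def[of P] ldiff_Inl_Inr summable_Inl_Inr)
    then show ?thesis
      using j by blast
  next
    case EE
    \<comment> \<open>Removing \<open>i\<close> from \<open>\<eta>a\<close> leaves an element of
      \<open>\<eta>P\<close>, which has no sum with \<open>\<eta>b\<close>: the premise
      fails.\<close>
    then have "summable P (\<gamma> i) a"
      using i le by (simp add: le_Inl_Inr summable_gamma)
    then obtain c where "psum P (\<gamma> i) a = Some c"
      by (auto simp: summable_def)
    then have "rdiff U x i' = Inr c"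
      using EE i by (simp add: rdiff_Inr_Inl)
    then show ?thesis
      using sm EE by (simp add: summable_def psum_Inr_Inr)
  qed
next
  let ?I = "Inl ` carrier P"
  fix i' x y
  assume "i' \<in> ?I" and x: "x \<in> carrier U" and y: "y \<in> carrier U" and le: "le U i' x"
    and sm: "summable U y (ldiff U i' x)"
  then obtain i where i: "i' = Inl i" "i \<in> carrier P"
    by blast
  consider (P) "y \<in> ?I"
    | (PE) a b where "a \<in> carrier P" "b \<in> carrier P" "x = Inl a" "y = Inr b"
    | (EE) a b where "a \<in> carrier P" "b \<in> carrier P" "x = Inr a" "y = Inr b"
    using x y by (auto simp: carrier_U)
  then show "\<exists>k\<in>?I. le U k y \<and> summable U (rdiff U y k) x"
  proof cases
    case P
    then show ?thesis
      using x y U_le_refl U_rdiff_self U_summable_zero by metis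
  next
    case PE
    \<comment> \<open>The right difference of \<open>\<eta>b\<close> by \<open>k\<close> is
      \<open>\<eta>(\<gamma> k \<oplus> b)\<close>, and \<open>\<eta>u + a\<close> requires
      \<open>\<gamma> a \<le> u\<close>. So \<open>\<gamma> a\<close> is bounded instead of
      \<open>a\<close>, and \<open>k\<close> is the \<open>\<gamma>\<close>-preimage of the left
      complement \<open>d\<close>.\<close>
    obtain u where u: "le P (\<gamma> a) u" "le P b u"
      using dir PE gamma_closed unfolding upward_directed_def by meson
    then obtain d where d: "d \<in> carrier P" "psum P d b = Some u"
      using PE by (auto simp: le_iff_left_summand)
    obtain k where k: "k \<in> carrier P" "\<gamma> k = d"
      using gamma_surj[OF d(1)] .
    have "summable P b k"
      using summable_gamma[of k b] k d PE by (simp add: summable_def)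
    then have "le U (Inl k) y" "summable U (rdiff U y (Inl k)) x"
      using PE k d u by (simp_all add: le_Inl_Inr rdiff_Inr_Inl summable_Inr_Inl)
    then show ?thesis
      using k by blast
  next
    case EE
    then obtain c where "psum P a i = Some c"
      using i le by (auto simp: le_Inl_Inr summable_def)
    then have "ldiff U i' x = Inr c"
      using EE i by (simp add: ldiff_Inl_Inr)
    then show ?thesis
      using sm EE by (simp add: summable_def psum_Inr_Inr)
  qed
qed

section \<open>Directedness from R2\<close>

lemma upward_directed_if_R2:
  assumes "R2 U (Inl ` carrier P)"
  shows "upward_directed P"
  unfolding upward_directed_def
proof (intro ballI)
  fix a b assume a: "a \<in> carrier P" and b: "b \<in> carrier P"
  then have U: "Inl a \<in> carrier U" "Inr b \<in> carrier U"
    by (auto simp: carrier_U)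
  have "summable U (rdiff U (Inl a) (Inl a)) (Inr b)"
    using U by (simp add: U_rdiff_self U_summable_zero)
  then obtain j where j: "j \<in> carrier P" "le U (Inl j) (Inr b)"
      "summable U (Inl a) (ldiff U (Inl j) (Inr b))"
    using assms a U U_le_refl[OF U(1)] unfolding R2_def by blast
  then obtain c where c: "psum P b j = Some c"
    using b by (auto simp: le_Inl_Inr summable_def)
  \<comment> \<open>The difference \<open>j / \<eta>b\<close> is \<open>\<eta>c\<close>, and
    \<open>a + \<eta>c\<close> is defined only if \<open>a \<le> c\<close>.\<close>
  then have "le P a c"
    using a b j by (simp add: ldiff_Inl_Inr summable_Inl_Inr)
  moreover have "le P b c" "c \<in> carrier P"
    using c j sum_closed[OF b j(1) c] by (auto simp: le_def)
  ultimately show "\<exists>c\<in>carrier P. le P a c \<and> le P b c"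
    by blast
qed

end

theorem theorem4p12:
  fixes P :: "'a partial_alg" and \<gamma> :: "'a \<Rightarrow> 'a"
  assumes "gpea P" and "unitizing_automorphism P \<gamma>"
  shows "normal_ideal (unitization P \<gamma>) (Inl ` carrier P) \<and>
         riesz_ideal (unitization P \<gamma>) (Inl ` carrier P) \<longleftrightarrow> upward_directed P"
proof -
  interpret gpea P by fact
  interpret unitizing_gpea P \<gamma> by unfold_locales fact
  show ?thesis
    using normal_ideal_P R1_P R2_P upward_directed_if_R2
    by (auto simp: riesz_ideal_def R1_ideal_def normal_ideal_def)
qed

end
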